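(* Let $(X,* )$ be a topological group with identity $x_0$, and let $d$ be a metric on $X$ that induces its topology. Suppose that there is a dilation family $\{T_\alpha\}_{\alpha\in[0,\infty)}$ on $(X,d,x_0)$ consisting of group homomorphisms of $(X,* )$. If the collection of translation maps $\{\rho_c\}_{c\in X}$, where $\rho_c(x)=c*x$, is equicontinuous with respect to $d$, then the function $D:X\times X\to\mathbb{R}_{\ge0}$ defined by $D(x,y)=\sup\{d(c*x,c*y): c\in X\}$ is a (well-defined, finite) metric on $X$ that induces the same topology on $X$ as $d$, and $\{T_\alpha\}_{\alpha\in[0,\infty)}$ is a dilation family on $(X,D,x_0)$. Furthermore, $\|x\|=D(x,x_0)$ $(x\in X)$ defines a homogeneous norm on $X$.
   Context: Dilation: a map $h:X\to X$ is a dilation of scale $\alpha\ge0$ with respect to a metric $d$ if $d(h(x),h(y))=\alpha\,d(x,y)$ for all $x,y$. Dilation family: a family $\{T_\alpha\}_{\alpha\in I}$ of maps $X\to X$, with $I\subset\mathbb{R}_{\ge0}$ closed under multiplication, is a dilation family on $(X,d,x_0)$ if (1) each $T_\alpha$ is a dilation of scale $\alpha$ with respect to $d$; (2) $T_\alpha(x_0)=x_0$ for all $\alpha\in I$; (3) $T_\alpha\circ T_\beta=T_{\alpha\beta}$ for all $\alpha,\beta\in I$; (4) for every $x\in X$ the limit $\lim_{\alpha\to1}T_\alpha(x)$ ($\alpha\in I$) exists in $X$. Equicontinuity of $\{\rho_c\}_{c\in X}$ with respect to $d$: for every $x\in X$ and $\varepsilon>0$ there is $\delta>0$ such that $d(x,y)<\delta$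 implies $d(c*x,c*y)<\varepsilon$ for all $c\in X$. Homogeneous norm (with respect to $\{T_\alpha\}$): a function $\|\cdot\|:X\to\mathbb{R}_{\ge0}$ such that $\|x\|=0$ iff $x=x_0$, $\|x^{-1}\|=\|x\|$, $\|x*y\|\le\|x\|+\|y\|$, and $\|T_\alpha(x)\|=\alpha\|x\|$ for all $x,y\in X$ and $\alpha\in[0,\infty)$. *)

theory Defs
  imports "HOL-Analysis.Analysis" "HOL-Algebra.Group"
begin

(* Metric spaces are (X, d) with d a total function on the ambient type, as in the locale
   Metric_space; that locale asks for nonnegativity and symmetry on the whole type and for the
   remaining axioms on X only. *)

definition topological_group :: "('a, 'b) monoid_scheme \<Rightarrow> 'a topology \<Rightarrow> bool" where
  "topological_group G \<tau> \<longleftrightarrow>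
     group G \<and> topspace \<tau> = carrier G \<and>
     continuous_map (prod_topology \<tau> \<tau>) \<tau> (\<lambda>(x, y). x \<otimes>\<^bsub>G\<^esub> y) \<and>
     continuous_map \<tau> \<tau> (\<lambda>x. inv\<^bsub>G\<^esub> x)"

definition dilation :: "'a set \<Rightarrow> ('a \<Rightarrow> 'a \<Rightarrow> real) \<Rightarrow> real \<Rightarrow> ('a \<Rightarrow> 'a) \<Rightarrow> bool" where
  "dilation X d \<alpha> h \<longleftrightarrow>
     0 \<le> \<alpha> \<and> h \<in> X \<rightarrow> X \<and> (\<forall>x\<in>X. \<forall>y\<in>X. d (h x) (h y) = \<alpha> * d x y)"

(* The limit is taken through parameters in I different from 1. *)
definition dilation_family ::
  "'a set \<Rightarrow> ('a \<Rightarrow> 'a \<Rightarrow> real) \<Rightarrow> 'a \<Rightarrow> real set \<Rightarrow> (real \<Rightarrow> 'a \<Rightarrow> 'a) \<Rightarrow> bool" where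
  "dilation_family X d x0 I T \<longleftrightarrow>
     Metric_space X d \<and> x0 \<in> X \<and>
     I \<subseteq> {0..} \<and> (\<forall>\<alpha>\<in>I. \<forall>\<beta>\<in>I. \<alpha> * \<beta> \<in> I) \<and>
     (\<forall>\<alpha>\<in>I. dilation X d \<alpha> (T \<alpha>)) \<and>
     (\<forall>\<alpha>\<in>I. T \<alpha> x0 = x0) \<and>
     (\<forall>\<alpha>\<in>I. \<forall>\<beta>\<in>I. \<forall>x\<in>X. T \<alpha> (T \<beta> x) = T (\<alpha> * \<beta>) x) \<and>
     (\<forall>x\<in>X. \<exists>l\<in>X. limitin (Metric_space.mtopology X d) (\<lambda>\<alpha>. T \<alpha> x) l (at 1 within I))"

definition equicontinuous_translations ::
  "('a, 'b) monoid_scheme \<Rightarrow> ('a \<Rightarrow> 'a \<Rightarrow> real) \<Rightarrow> bool" where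
  "equicontinuous_translations G d \<longleftrightarrow>
     (\<forall>x\<in>carrier G. \<forall>\<epsilon>>0. \<exists>\<delta>>0. \<forall>y\<in>carrier G. d x y < \<delta> \<longrightarrow>
        (\<forall>c\<in>carrier G. d (c \<otimes>\<^bsub>G\<^esub> x) (c \<otimes>\<^bsub>G\<^esub> y) < \<epsilon>))"

(* The value 0 outside the carrier is only there to meet the convention of Metric_space above.
   The real-valued supremum is meaningful only when the set is bounded above. *)
definition sup_metric ::
  "('a, 'b) monoid_scheme \<Rightarrow> ('a \<Rightarrow> 'a \<Rightarrow> real) \<Rightarrow> 'a \<Rightarrow> 'a \<Rightarrow> real" where
  "sup_metric G d x y =
     (if x \<in> carrier G \<and> y \<in> carrier G
      then (SUP c\<in>carrier G. d (c \<otimes>\<^bsub>G\<^esub> x) (c \<otimes>\<^bsub>G\<^esub> y)) else 0)"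

definition homogeneous_norm ::
  "('a, 'b) monoid_scheme \<Rightarrow> (real \<Rightarrow> 'a \<Rightarrow> 'a) \<Rightarrow> ('a \<Rightarrow> real) \<Rightarrow> bool" where
  "homogeneous_norm G T N \<longleftrightarrow>
     (\<forall>x\<in>carrier G. 0 \<le> N x) \<and>
     (\<forall>x\<in>carrier G. N x = 0 \<longleftrightarrow> x = \<one>\<^bsub>G\<^esub>) \<and>
     (\<forall>x\<in>carrier G. N (inv\<^bsub>G\<^esub> x) = N x) \<and>
     (\<forall>x\<in>carrier G. \<forall>y\<in>carrier G. N (x \<otimes>\<^bsub>G\<^esub> y) \<le> N x + N y) \<and>
     (\<forall>\<alpha>\<ge>0. \<forall>x\<in>carrier G. N (T \<alpha> x) = \<alpha> * N x)"

end

theory Submission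
  imports Defs
begin

text \<open>Equicontinuity at the identity bounds \<open>d(c, c * y)\<close> uniformly in \<open>c\<close> for small \<open>y\<close>. A
  dilation \<open>T\<^sub>\<alpha>\<close> with small \<open>\<alpha> > 0\<close> moves any \<open>x\<close> into that range, and since it is a homomorphism,
  \<open>\<alpha> * d(c, c * x) = d(T\<^sub>\<alpha> c, T\<^sub>\<alpha> c * T\<^sub>\<alpha> x)\<close>; so \<open>D\<close> is finite. It dominates \<open>d\<close>, equicontinuity gives
  the reverse comparison of topologies, and \<open>T\<^sub>\<alpha>\<close> being a bijection for \<open>\<alpha> > 0\<close> gives the scaling of
  \<open>D\<close>. The norm axioms follow from left invariance of \<open>D\<close>.\<close>

section \<open>Identity and surjectivity in a dilation family\<close>

text \<open>\<open>T 1\<close> is an isometry and, by the composition law, idempotent; so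
  \<open>T 1 x\<close> and \<open>x\<close>, which have the same image, are at distance 0.\<close>

lemma dilation_family_one:
  assumes "dilation_family X d x0 I T" "1 \<in> I" "x \<in> X"
  shows "T 1 x = x"
proof -
  have ms: "Metric_space X d" and dil: "dilation X d 1 (T 1)" and idem: "T 1 (T 1 x) = T 1 x"
    using assms unfolding dilation_family_def by (auto dest: bspec[where x = 1])
  have T: "T 1 x \<in> X"
    using dil assms(3) by (auto simp: dilation_def)
  then have "d (T 1 (T 1 x)) (T 1 x) = d (T 1 x) x"
    using dil assms(3) by (auto simp: dilation_def)
  then show ?thesis
    using idem Metric_space.zero[OF ms] T assms(3) by metis
qed

text \<open>\<open>T (inverse \<alpha>) x\<close> is a preimage of \<open>x\<close>: the composite
  is \<open>T 1\<close>, the identity on \<open>X\<close>.\<close>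

lemma dilation_family_surj:
  assumes "dilation_family X d x0 I T" "\<alpha> \<in> I" "inverse \<alpha> \<in> I" "\<alpha> \<noteq> 0"
  shows "T \<alpha> ` X = X"
proof
  show "T \<alpha> ` X \<subseteq> X"
    using assms(1,2) by (auto simp: dilation_family_def dilation_def)
  show "X \<subseteq> T \<alpha> ` X"
  proof
    fix x assume x: "x \<in> X"
    have "T (inverse \<alpha>) x \<in> X"
      using assms(1,3) x by (auto simp: dilation_family_def dilation_def)
    moreover have "T \<alpha> (T (inverse \<alpha>) x) = T (\<alpha> * inverse \<alpha>) x" "\<alpha> * inverse \<alpha> \<in> I"
      using assms(1-3) x by (auto simp: dilation_family_def)
    ultimately show "x \<in> T \<alpha> ` X"
      using dilation_family_one[OF assms(1) _ x] assms(4) by (metis image_eqI right_inverse)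
  qed
qed

section \<open>Finiteness of the supremum\<close>

text \<open>By the triangle inequality through \<open>c\<close> it is enough to bound the
  displacement \<open>d c (c \<otimes> x)\<close> uniformly in \<open>c\<close>.\<close>

lemma translations_bounded:
  fixes G (structure)
  assumes G: "group G"
    and fam: "dilation_family (carrier G) d \<one> {0..} T"
    and hom: "\<And>\<alpha>. 0 \<le> \<alpha> \<Longrightarrow> T \<alpha> \<in> hom G G"
    and eq: "equicontinuous_translations G d"
    and x: "x \<in> carrier G" and y: "y \<in> carrier G"
  shows "bdd_above ((\<lambda>c. d (c \<otimes> x) (c \<otimes> y)) ` carrier G)"
proof -
  interpret group G by (rule G)
  interpret Metric_space "carrier G" d
    using fam by (simp add: dilation_family_def)
  have dil: "dilation (carrier G) d \<alpha> (T \<alpha>)" and fix1: "T \<alpha> \<one> = \<one>" if "0 \<le> \<alpha>" for \<alpha>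
    using fam that by (auto simp: dilation_family_def)
  obtain \<delta> where \<delta>: "\<delta> > 0"
    "\<And>y c. y \<in> carrier G \<Longrightarrow> d \<one> y < \<delta> \<Longrightarrow> c \<in> carrier G \<Longrightarrow> d (c \<otimes> \<one>) (c \<otimes> y) < 1"
    using eq[unfolded equicontinuous_translations_def, rule_format, of \<one> 1] by auto
  have bound: "\<exists>B. \<forall>c\<in>carrier G. d c (c \<otimes> x) \<le> B" if x: "x \<in> carrier G" for x
  proof -
    \<comment> \<open>Any \<alpha> > 0 with \<open>\<alpha> * d \<one> x < \<delta>\<close> serves;
      the summand 1 keeps the denominator positive when \<open>x\<close> is the identity.\<close>
    define \<alpha> where "\<alpha> = \<delta> / (d \<one> x + 1)"
    have pos: "\<alpha> > 0"
      using \<delta>(1) nonneg[of \<one> x] unfolding \<alpha>_def by (intro divide_pos_pos) linarith+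
    have T: "T \<alpha> z \<in> carrier G" if "z \<in> carrier G" for z
      using dil[of \<alpha>] pos that by (auto simp: dilation_def)
    have scale: "d (T \<alpha> u) (T \<alpha> v) = \<alpha> * d u v" if "u \<in> carrier G" "v \<in> carrier G" for u v
      using dil[of \<alpha>] pos that by (auto simp: dilation_def)
    have "\<alpha> * d \<one> x < \<alpha> * (d \<one> x + 1)"
      using pos by simp
    also have "\<dots> = \<delta>"
      using nonneg[of \<one> x] unfolding \<alpha>_def by (simp add: field_simps add_nonneg_eq_0_iff)
    finally have small: "d \<one> (T \<alpha> x) < \<delta>"
      using scale[of \<one> x] x fix1[of \<alpha>] pos by simp
    have "d c (c \<otimes> x) \<le> 1 / \<alpha>" if c: "c \<in> carrier G" for c
    proof -
      \<comment> \<open>\<open>T \<alpha> c\<close> is itself a translation parameter, so the bound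
        1 near the identity applies to it; dividing by \<alpha> gives a bound free of
        \<open>c\<close>.\<close>
      have "\<alpha> * d c (c \<otimes> x) = d (T \<alpha> c) (T \<alpha> c \<otimes> T \<alpha> x)"
        using scale[of c "c \<otimes> x"] hom_mult[OF hom[of \<alpha>] c x] pos c x by simp
      also have "\<dots> < 1"
        using \<delta>(2)[OF T[OF x] small T[OF c]] T[OF c] by simp
      finally show ?thesis
        using pos by (simp add: field_simps)
    qed
    then show ?thesis by blast
  qed
  obtain A B where A: "\<And>c. c \<in> carrier G \<Longrightarrow> d c (c \<otimes> x) \<le> A"
    and B: "\<And>c. c \<in> carrier G \<Longrightarrow> d c (c \<otimes> y) \<le> B"
    using bound[OF x] bound[OF y] by blast
  show ?thesis
  proof (rule bdd_aboveI2)
    fix c assume c: "c \<in> carrier G"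
    show "d (c \<otimes> x) (c \<otimes> y) \<le> A + B"
      using triangle[of "c \<otimes> x" c "c \<otimes> y"] A[OF c] B[OF c] commute[of c "c \<otimes> x"] c x y by simp
  qed
qed

section \<open>The supremum metric and its topology\<close>

text \<open>\<open>bdd\<close> makes the real-valued supremum in \<open>sup_metric\<close> a true
  least upper bound. Dilations and equicontinuity enter as hypotheses of the single lemmas that use
  them.\<close>

locale bounded_translations = group G + Metric_space "carrier G" d
  for G (structure) and d +
  assumes bdd: "\<lbrakk>x \<in> carrier G; y \<in> carrier G\<rbrakk>
    \<Longrightarrow> bdd_above ((\<lambda>c. d (c \<otimes> x) (c \<otimes> y)) ` carrier G)"
begin

lemma sup_metric_upper:
  assumes "x \<in> carrier G" "y \<in> carrier G" "c \<in> carrier G"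
  shows "d (c \<otimes> x) (c \<otimes> y) \<le> sup_metric G d x y"
  using assms cSUP_upper[OF assms(3) bdd[OF assms(1,2)]] by (simp add: sup_metric_def)

lemma sup_metric_least:
  assumes "x \<in> carrier G" "y \<in> carrier G"
    and "\<And>c. c \<in> carrier G \<Longrightarrow> d (c \<otimes> x) (c \<otimes> y) \<le> B"
  shows "sup_metric G d x y \<le> B"
  using assms by (auto simp: sup_metric_def intro!: cSUP_least)

lemma le_sup_metric:
  assumes "x \<in> carrier G" "y \<in> carrier G"
  shows "d x y \<le> sup_metric G d x y"
  using sup_metric_upper[OF assms one_closed] assms by simp

text \<open>Symmetry and the triangle inequality pass to the supremum; separation holds because
  \<open>d\<close> is a lower bound for it.\<close>

sublocale sup: Metric_space "carrier G" "sup_metric G d"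
proof
  fix x y
  show "0 \<le> sup_metric G d x y"
    \<comment> \<open>On the carrier \<open>d\<close> bounds the value from below; off it the
      default value 0 applies.\<close>
    using order_trans[OF nonneg le_sup_metric, of x y]
    by (cases "x \<in> carrier G \<and> y \<in> carrier G") (auto simp: sup_metric_def)
  show "sup_metric G d x y = sup_metric G d y x"
    by (simp add: sup_metric_def commute)
next
  fix x y assume xy: "x \<in> carrier G" "y \<in> carrier G"
  show "sup_metric G d x y = 0 \<longleftrightarrow> x = y"
  proof
    assume "sup_metric G d x y = 0"
    then show "x = y"
      using le_sup_metric[OF xy] nonneg[of x y] xy by simp
  next
    assume "x = y"
    \<comment> \<open>The supremum of the constant 0 is known to be 0 only over a nonempty index
      set.\<close>
    moreover have "carrier G \<noteq> {}"
      using xy by blast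
    ultimately show "sup_metric G d x y = 0"
      using xy by (simp add: sup_metric_def)
  qed
next
  fix x y z assume xyz: "x \<in> carrier G" "y \<in> carrier G" "z \<in> carrier G"
  show "sup_metric G d x z \<le> sup_metric G d x y + sup_metric G d y z"
  proof (rule sup_metric_least)
    fix c assume c: "c \<in> carrier G"
    show "d (c \<otimes> x) (c \<otimes> z) \<le> sup_metric G d x y + sup_metric G d y z"
      using triangle[of "c \<otimes> x" "c \<otimes> y" "c \<otimes> z"] sup_metric_upper[of x y c]
        sup_metric_upper[of y z c] xyz c by simp
  qed (use xyz in auto)
qed

text \<open>Every \<open>c \<otimes> a\<close> is again a translation parameter, which gives one
  inequality for all \<open>a\<close>; applied to \<open>inv a\<close> it gives the
  converse.\<close>

lemma sup_metric_translate:
  assumes a: "a \<in> carrier G" and x: "x \<in> carrier G" and y: "y \<in> carrier G"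
  shows "sup_metric G d (a \<otimes> x) (a \<otimes> y) = sup_metric G d x y"
proof -
  have le: "sup_metric G d (a \<otimes> x) (a \<otimes> y) \<le> sup_metric G d x y"
    if "a \<in> carrier G" "x \<in> carrier G" "y \<in> carrier G" for a x y
  proof (rule sup_metric_least)
    fix c assume "c \<in> carrier G"
    then show "d (c \<otimes> (a \<otimes> x)) (c \<otimes> (a \<otimes> y)) \<le> sup_metric G d x y"
      using sup_metric_upper[of x y "c \<otimes> a"] that by (simp add: m_assoc)
  qed (use that in auto)
  have "sup_metric G d (inv a \<otimes> (a \<otimes> x)) (inv a \<otimes> (a \<otimes> y)) \<le> sup_metric G d (a \<otimes> x) (a \<otimes> y)"
    using a x y by (intro le) auto
  then show ?thesis
    using le[OF a x y] a x y by (simp add: m_assoc[symmetric])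
qed

text \<open>Since \<open>d\<close> is the smaller metric, balls of the new metric lie inside those
  of \<open>d\<close>; equicontinuity at the centre gives the reverse nesting with another
  radius.\<close>

lemma sup_mtopology:
  assumes eq: "equicontinuous_translations G d"
  shows "sup.mtopology = mtopology"
proof (rule topology_eq[THEN iffD2, rule_format])
  have 1: "sup.mball x r \<subseteq> mball x r" for x r
    using le_sup_metric by (fastforce simp: subset_eq)
  have 2: "\<exists>s>0. mball x s \<subseteq> sup.mball x r" if r: "r > 0" and x: "x \<in> carrier G" for x r
  proof -
    \<comment> \<open>Strict bounds by \<open>r / 2\<close> on all translates leave the supremum at
      most \<open>r / 2\<close>, hence below \<open>r\<close>.\<close>
    obtain s where s: "s > 0" "\<And>y c. y \<in> carrier G \<Longrightarrow> d x y < s \<Longrightarrow> c \<in> carrier G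
        \<Longrightarrow> d (c \<otimes> x) (c \<otimes> y) < r / 2"
      using eq[unfolded equicontinuous_translations_def, rule_format, of x "r / 2"] r x by auto
    have "sup_metric G d x y \<le> r / 2" if "y \<in> carrier G" "d x y < s" for y
      using that s(2) x by (intro sup_metric_least) (auto intro: less_imp_le)
    then have "mball x s \<subseteq> sup.mball x r"
      using r by (fastforce simp: subset_eq)
    then show ?thesis
      using s(1) by blast
  qed
  fix U
  show "openin sup.mtopology U \<longleftrightarrow> openin mtopology U"
  proof
    assume "openin sup.mtopology U"
    then show "openin mtopology U"
      unfolding sup.openin_mtopology openin_mtopology using 2 by (meson order_trans subsetD)
  next
    assume "openin mtopology U"
    then show "openin sup.mtopology U"
      unfolding sup.openin_mtopology openin_mtopology using 1 by (meson order_trans)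
  qed
qed

section \<open>Dilations and the homogeneous norm\<close>

text \<open>A homomorphism carries the translate by \<open>c\<close> to the translate by
  \<open>T \<alpha> c\<close>. For \<alpha> > 0 the parameters \<open>T \<alpha> c\<close> exhaust
  the group, so both suprema run over the same scaled values.\<close>

lemma sup_metric_scale:
  assumes fam: "dilation_family (carrier G) d \<one> {0..} T"
    and hom: "T \<alpha> \<in> hom G G" and \<alpha>: "0 \<le> \<alpha>"
    and x: "x \<in> carrier G" and y: "y \<in> carrier G"
  shows "sup_metric G d (T \<alpha> x) (T \<alpha> y) = \<alpha> * sup_metric G d x y"
proof -
  have T: "T \<alpha> z \<in> carrier G" if "z \<in> carrier G" for z
    using hom that by (auto simp: hom_def)
  have scale: "d (T \<alpha> u) (T \<alpha> v) = \<alpha> * d u v" if "u \<in> carrier G" "v \<in> carrier G" for u v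
    using fam \<alpha> that by (auto simp: dilation_family_def dilation_def)
  show ?thesis
  proof (cases "\<alpha> = 0")
    case True
    \<comment> \<open>Scale 0 collapses all points to one, so both sides vanish.\<close>
    then have "T \<alpha> x = T \<alpha> y"
      using scale[OF x y] T x y by simp
    then show ?thesis
      using True T[OF y] by simp
  next
    case False
    have tr: "d (T \<alpha> c \<otimes> T \<alpha> x) (T \<alpha> c \<otimes> T \<alpha> y) = \<alpha> * d (c \<otimes> x) (c \<otimes> y)"
      if "c \<in> carrier G" for c
      using scale[of "c \<otimes> x" "c \<otimes> y"] hom_mult[OF hom] that x y by simp
    have surj: "T \<alpha> ` carrier G = carrier G"
      using dilation_family_surj[OF fam, of \<alpha>] \<alpha> False by simp
    show ?thesis
    proof (rule antisym)
      show "sup_metric G d (T \<alpha> x) (T \<alpha> y) \<le> \<alpha> * sup_metric G d x y"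
      proof (rule sup_metric_least)
        fix c assume "c \<in> carrier G"
        then obtain b where "b \<in> carrier G" "c = T \<alpha> b"
          using surj by blast
        then show "d (c \<otimes> T \<alpha> x) (c \<otimes> T \<alpha> y) \<le> \<alpha> * sup_metric G d x y"
          using tr sup_metric_upper[OF x y] \<alpha> by (simp add: mult_left_mono)
      qed (use T x y in auto)
      have "sup_metric G d x y \<le> sup_metric G d (T \<alpha> x) (T \<alpha> y) / \<alpha>"
      proof (rule sup_metric_least[OF x y])
        fix c assume c: "c \<in> carrier G"
        show "d (c \<otimes> x) (c \<otimes> y) \<le> sup_metric G d (T \<alpha> x) (T \<alpha> y) / \<alpha>"
          using tr[OF c] sup_metric_upper[OF T[OF x] T[OF y] T[OF c]] \<alpha> False
          by (simp add: field_simps)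
      qed
      then show "\<alpha> * sup_metric G d x y \<le> sup_metric G d (T \<alpha> x) (T \<alpha> y)"
        using \<alpha> False by (simp add: field_simps)
    qed
  qed
qed

lemma homogeneous_norm_sup_metric:
  assumes fam: "dilation_family (carrier G) d \<one> {0..} T"
    and hom: "\<And>\<alpha>. 0 \<le> \<alpha> \<Longrightarrow> T \<alpha> \<in> hom G G"
  shows "homogeneous_norm G T (\<lambda>x. sup_metric G d x \<one>)"
  unfolding homogeneous_norm_def
proof (intro conjI ballI allI impI)
  fix x assume x: "x \<in> carrier G"
  show "0 \<le> sup_metric G d x \<one>"
    by simp
  show "sup_metric G d x \<one> = 0 \<longleftrightarrow> x = \<one>"
    using x by simp
  \<comment> \<open>Translation by \<open>x\<close> takes the pair \<open>inv x\<close>,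
    \<open>\<one>\<close> to \<open>\<one>\<close>, \<open>x\<close>.\<close>
  show "sup_metric G d (inv x) \<one> = sup_metric G d x \<one>"
    using sup_metric_translate[of x "inv x" \<one>] x sup.commute[of x \<one>] by simp
  fix y assume y: "y \<in> carrier G"
  \<comment> \<open>Pass through \<open>x\<close>: translation invariance turns the distance from
    \<open>x \<otimes> y\<close> to \<open>x\<close> into that from \<open>y\<close> to
    \<open>\<one>\<close>.\<close>
  show "sup_metric G d (x \<otimes> y) \<one> \<le> sup_metric G d x \<one> + sup_metric G d y \<one>"
    using sup.triangle[of "x \<otimes> y" x \<one>] sup_metric_translate[of x y \<one>] x y by simp
next
  fix \<alpha> :: real and x assume "0 \<le> \<alpha>" "x \<in> carrier G"
  moreover from this have "T \<alpha> \<one> = \<one>"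
    using fam by (auto simp: dilation_family_def)
  ultimately show "sup_metric G d (T \<alpha> x) \<one> = \<alpha> * sup_metric G d x \<one>"
    using sup_metric_scale[OF fam hom, of \<alpha> x \<one>] by simp
qed

end

theorem proposition2p11:
  fixes G :: "('a, 'b) monoid_scheme"
    and \<tau> :: "'a topology"
    and d :: "'a \<Rightarrow> 'a \<Rightarrow> real"
    and T :: "real \<Rightarrow> 'a \<Rightarrow> 'a"
  assumes "topological_group G \<tau>"
    and "Metric_space (carrier G) d"
    and "Metric_space.mtopology (carrier G) d = \<tau>"
    and "dilation_family (carrier G) d \<one>\<^bsub>G\<^esub> {0..} T"
    and "\<And>\<alpha>. 0 \<le> \<alpha> \<Longrightarrow> T \<alpha> \<in> hom G G"
    and "equicontinuous_translations G d"
  shows "(\<forall>x\<in>carrier G. \<forall>y\<in>carrier G.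
            bdd_above ((\<lambda>c. d (c \<otimes>\<^bsub>G\<^esub> x) (c \<otimes>\<^bsub>G\<^esub> y)) ` carrier G))
         \<and> Metric_space (carrier G) (sup_metric G d)
         \<and> Metric_space.mtopology (carrier G) (sup_metric G d) = \<tau>
         \<and> dilation_family (carrier G) (sup_metric G d) \<one>\<^bsub>G\<^esub> {0..} T
         \<and> homogeneous_norm G T (\<lambda>x. sup_metric G d x \<one>\<^bsub>G\<^esub>)"
proof -
  have G: "group G"
    using assms(1) by (simp add: topological_group_def)
  note bdd = translations_bounded[OF G assms(4-6)]
  interpret bounded_translations G d
    using G assms(2) bdd by (simp add: bounded_translations_def bounded_translations_axioms_def)
  have top: "sup.mtopology = mtopology"
    by (rule sup_mtopology[OF assms(6)])
  have "dilation (carrier G) (sup_metric G d) \<alpha> (T \<alpha>)" if "0 \<le> \<alpha>" for \<alpha>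
    using assms(5)[OF that] sup_metric_scale[OF assms(4) assms(5)[OF that] that] that
    by (auto simp: dilation_def hom_def)
  \<comment> \<open>The limit as \<alpha> tends to 1 depends on the metric only through its
    topology, so \<open>top\<close> carries it over from \<open>d\<close>.\<close>
  then have "dilation_family (carrier G) (sup_metric G d) \<one>\<^bsub>G\<^esub> {0..} T"
    using assms(4) sup.Metric_space_axioms unfolding dilation_family_def top by simp
  then show ?thesis
    using bdd sup.Metric_space_axioms top assms(3) homogeneous_norm_sup_metric[OF assms(4,5)]
    by (intro conjI ballI) simp_all
qed

end
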